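(* There exists an absolute constant $c>0$ such that for every integer $n\ge 2$, every essential cover of the $n$-cube $\{0,1\}^n$ by hyperplanes consists of at least $c\,\dfrac{n^{5/9}}{(\log n)^{4/9}}$ hyperplanes.
   Context: A collection of $k$ hyperplanes in $\mathbb{R}^n$ with equations $\langle v_i,x\rangle=\mu_i$ ($v_i\in\mathbb{R}^n$, $\mu_i\in\mathbb{R}$, $i\in[k]$, where $[k]=\{1,\dots,k\}$ and $\langle\cdot,\cdot\rangle$ is the standard scalar product) is an essential cover of the $n$-cube $\{0,1\}^n$ if: (E1) every $x\in\{0,1\}^n$ satisfies $\langle v_i,x\rangle=\mu_i$ for some $i\in[k]$; (E2) for every coordinate $j\in[n]$ there is $i\in[k]$ with $v_{ij}\neq 0$; (E3) for every $i\in[k]$ there is $x\in\{0,1\}^n$ with $\langle v_i,x\rangle=\mu_i$ but $\langle v_j,x\rangle\neq\mu_j$ for all $j\neq i$. Logarithms are natural. *)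

theory Defs
  imports Complex_Main "HOL-Library.FuncSet"
begin

text \<open>Vectors of the \<open>n\<close>-dimensional real space are functions on naturals, of which only
  the coordinates in \<open>{1..n}\<close> are ever inspected.\<close>

definition scalar_product :: "nat \<Rightarrow> (nat \<Rightarrow> real) \<Rightarrow> (nat \<Rightarrow> real) \<Rightarrow> real" where
  "scalar_product n v x = (\<Sum>j\<in>{1..n}. v j * x j)"

definition cube :: "nat \<Rightarrow> (nat \<Rightarrow> real) set" where
  "cube n = {1..n} \<rightarrow>\<^sub>E {0, 1}"

text \<open>The first conjunct says that each equation \<open>scalar_product n (v i) x = \<mu> i\<close>
  defines a hyperplane, i.e. has a nonzero normal vector.\<close>

definition essential_cover ::
  "nat \<Rightarrow> nat \<Rightarrow> (nat \<Rightarrow> nat \<Rightarrow> real) \<Rightarrow> (nat \<Rightarrow> real) \<Rightarrow> bool" where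
  "essential_cover n k v \<mu> \<longleftrightarrow>
     (\<forall>i\<in>{1..k}. \<exists>j\<in>{1..n}. v i j \<noteq> 0) \<and>
     (\<forall>x\<in>cube n. \<exists>i\<in>{1..k}. scalar_product n (v i) x = \<mu> i) \<and>
     (\<forall>j\<in>{1..n}. \<exists>i\<in>{1..k}. v i j \<noteq> 0) \<and>
     (\<forall>i\<in>{1..k}. \<exists>x\<in>cube n. scalar_product n (v i) x = \<mu> i \<and>
        (\<forall>j\<in>{1..k} - {i}. scalar_product n (v j) x \<noteq> \<mu> j))"

end

theory Submission
  imports Defs "HOL-Probability.Hoeffding"
begin

text \<open>Identify cube points with sets of coordinates, and suppose that \<open>k\<close> is small. In an essential
  cover each hyperplane has at most \<open>2 k\<close> nonzero coefficients (Linial and Radhakrishnan), so after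
  discarding a quarter of the columns every column meets at most \<open>8 k\<^sup>2 / n\<close> rows. Next remove a few
  more columns so that on the remaining set \<open>R\<close> each row either has all its entries small compared
  to its Euclidean norm (it is spread), or contains a long sequence of entries at least halving in
  absolute value. Freeze the removed columns at a point witnessing (E3) for some row that does not
  vanish on \<open>R\<close>: this already avoids all rows vanishing on \<open>R\<close>. On \<open>R\<close>, Bang's lemma yields a
  point near the centre of the cube that is far from all the spread hyperplanes, and rounding it
  randomly keeps clear of them by Hoeffding's inequality; a row with \<open>L\<close> dyadic scales is hit with
  probability at most \<open>(3/4)\<^sup>L\<close>. Hence some point is not covered. This shows
  \<open>n\<^sup>3 = O(k\<^sup>5 (log n)\<^sup>2)\<close>, which is stronger than the theorem.\<close>

section \<open>The supports of the hyperplanes\<close>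

text \<open>The left side is an iterated finite difference, in \<open>card U\<close> directions, of
  a polynomial of degree at most \<open>card J\<close>. Splitting off one factor reduces it to
  alternating sums with one factor fewer, over \<open>U\<close> or over \<open>U\<close> minus a
  point.\<close>

lemma alternating_sum_prod_affine_eq_0:
  fixes \<alpha> :: "'i \<Rightarrow> 'c \<Rightarrow> real" and \<beta> :: "'i \<Rightarrow> real"
  assumes "finite J" "finite U" "card J < card U"
  shows "(\<Sum>A\<in>Pow U. (-1) ^ card A * (\<Prod>j\<in>J. \<beta> j + sum (\<alpha> j) A)) = 0"
  using assms
proof (induction J arbitrary: U \<beta> rule: finite_induct)
  case empty
  have "(\<Prod>x\<in>U. (-1) + (1::real)) = (\<Sum>A\<in>Pow U. (\<Prod>x\<in>A. -1) * (\<Prod>x\<in>U-A. 1))"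
    using empty by (intro prod_add) auto
  moreover have "(\<Prod>x\<in>U. (-1) + (1::real)) = 0"
    using empty by (auto simp: power_0_left)
  ultimately show ?case by simp
next
  case (insert j J)
  let ?P = "\<lambda>A. \<Prod>j\<in>J. \<beta> j + sum (\<alpha> j) A"
  \<comment> \<open>Deleting \<open>c\<close> from \<open>A\<close> flips the sign and moves
    \<open>\<alpha> j c\<close> into the constant terms, which is why \<open>\<beta>\<close> is
    generalised in the induction.\<close>
  have remove: "(\<Sum>A\<in>{A \<in> Pow U. c \<in> A}. (-1) ^ card A * ?P A) = 0" if c: "c \<in> U" for c
  proof -
    have "(\<Sum>A\<in>{A \<in> Pow U. c \<in> A}. (-1) ^ card A * ?P A) =
        (\<Sum>A\<in>Pow (U - {c}). (-1) ^ card (insert c A) * ?P (insert c A))"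
      by (rule sum.reindex_bij_witness[of _ "insert c" "\<lambda>A. A - {c}"]) (use c in \<open>auto simp: insert_absorb\<close>)
    also have "\<dots> = (\<Sum>A\<in>Pow (U - {c}). - ((-1) ^ card A * (\<Prod>j\<in>J. (\<beta> j + \<alpha> j c) + sum (\<alpha> j) A)))"
    proof (rule sum.cong[OF refl])
      fix A assume "A \<in> Pow (U - {c})"
      then have "finite A" "c \<notin> A"
        using insert.prems by (auto intro: finite_subset)
      then show "(-1) ^ card (insert c A) * ?P (insert c A) =
          - ((-1) ^ card A * (\<Prod>j\<in>J. (\<beta> j + \<alpha> j c) + sum (\<alpha> j) A))"
        by (simp add: add.assoc)
    qed
    also have "\<dots> = 0"
      unfolding sum_negf using insert.prems insert.hyps c by (subst insert.IH) auto
    finally show ?thesis .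
  qed
  have "(\<Sum>A\<in>Pow U. (-1) ^ card A * (\<Prod>j\<in>insert j J. \<beta> j + sum (\<alpha> j) A)) =
      (\<Sum>A\<in>Pow U. \<beta> j * ((-1) ^ card A * ?P A) +
        (\<Sum>c\<in>U. if c \<in> A then \<alpha> j c * ((-1) ^ card A * ?P A) else 0))"
  proof (rule sum.cong[OF refl])
    fix A assume A: "A \<in> Pow U"
    have "(\<Sum>c\<in>U. if c \<in> A then \<alpha> j c * ((-1) ^ card A * ?P A) else 0) =
        sum (\<alpha> j) A * ((-1) ^ card A * ?P A)"
      using A insert.prems
      by (subst sum.inter_restrict[symmetric]) (auto simp: sum_distrib_right Int_absorb1)
    then show "(-1) ^ card A * (\<Prod>j\<in>insert j J. \<beta> j + sum (\<alpha> j) A) =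
        \<beta> j * ((-1) ^ card A * ?P A) +
        (\<Sum>c\<in>U. if c \<in> A then \<alpha> j c * ((-1) ^ card A * ?P A) else 0)"
      using insert.hyps by (simp add: algebra_simps)
  qed
  also have "\<dots> = \<beta> j * (\<Sum>A\<in>Pow U. (-1) ^ card A * ?P A) +
      (\<Sum>c\<in>U. \<Sum>A\<in>Pow U. if c \<in> A then \<alpha> j c * ((-1) ^ card A * ?P A) else 0)"
    unfolding sum.distrib sum_distrib_left by (intro arg_cong2[of _ _ _ _ "(+)"] refl sum.swap)
  also have "(\<Sum>A\<in>Pow U. (-1) ^ card A * ?P A) = 0"
    using insert by (intro insert.IH) auto
  also have "(\<Sum>c\<in>U. \<Sum>A\<in>Pow U. if c \<in> A then \<alpha> j c * ((-1) ^ card A * ?P A) else 0) =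
      (\<Sum>c\<in>U. \<alpha> j c * (\<Sum>A\<in>{A \<in> Pow U. c \<in> A}. (-1) ^ card A * ?P A))"
  proof (rule sum.cong[OF refl])
    fix c assume "c \<in> U"
    show "(\<Sum>A\<in>Pow U. if c \<in> A then \<alpha> j c * ((-1) ^ card A * ?P A) else 0) =
        \<alpha> j c * (\<Sum>A\<in>{A \<in> Pow U. c \<in> A}. (-1) ^ card A * ?P A)"
      unfolding sum_distrib_left using insert.prems by (intro sum.inter_filter[symmetric]) auto
  qed
  also have "\<dots> = 0"
    using remove by simp
  finally show ?case by simp
qed

text \<open>The product of the affine forms vanishes at every subset of \<open>U\<close> except
  \<open>{}\<close>. Its alternating sum is therefore a single nonzero term, which is impossible
  when the degree is below the dimension.\<close>

lemma card_le_of_covering_all_but_one: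
  fixes \<alpha> :: "'i \<Rightarrow> 'c \<Rightarrow> real" and \<beta> :: "'i \<Rightarrow> real"
  assumes fin: "finite J" "finite U"
    and zero: "\<And>A. A \<subseteq> U \<Longrightarrow> A \<noteq> {} \<Longrightarrow> \<exists>j\<in>J. \<beta> j + sum (\<alpha> j) A = 0"
    and nonzero: "\<And>j. j \<in> J \<Longrightarrow> \<beta> j \<noteq> 0"
  shows "card U \<le> card J"
proof (rule ccontr)
  assume "\<not> ?thesis"
  then have "0 = (\<Sum>A\<in>Pow U. (-1) ^ card A * (\<Prod>j\<in>J. \<beta> j + sum (\<alpha> j) A))"
    using fin by (subst alternating_sum_prod_affine_eq_0) auto
  also have "\<dots> = (\<Sum>A\<in>{{}}. (-1) ^ card A * (\<Prod>j\<in>J. \<beta> j + sum (\<alpha> j) A))"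
  proof (rule sum.mono_neutral_right)
    show "\<forall>A\<in>Pow U - {{}}. (-1) ^ card A * (\<Prod>j\<in>J. \<beta> j + sum (\<alpha> j) A) = 0"
      using zero fin by (auto simp: prod_zero_iff)
  qed (use fin in auto)
  finally show False
    using nonzero fin by simp
qed

lemma sum_symdiff:
  fixes f :: "'c \<Rightarrow> real"
  assumes "finite A" "finite F"
  shows "sum f (A - F \<union> (F - A)) = sum f A + (\<Sum>c\<in>F. (if c \<in> A then -1 else 1) * f c)"
proof -
  have "(\<Sum>c\<in>F. (if c \<in> A then -1 else 1) * f c) =
      (\<Sum>c\<in>F \<inter> A. (if c \<in> A then -1 else 1) * f c) + (\<Sum>c\<in>F - A. (if c \<in> A then -1 else 1) * f c)"
    using assms by (intro sum.Int_Diff)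
  also have "\<dots> = - sum f (F \<inter> A) + sum f (F - A)"
    by (simp add: sum_negf)
  finally have "(\<Sum>c\<in>F. (if c \<in> A then -1 else 1) * f c) = sum f (F - A) - sum f (F \<inter> A)" by simp
  moreover have "sum f A = sum f (A \<inter> F) + sum f (A - F)"
    using assms by (intro sum.Int_Diff)
  moreover have "sum f (A - F \<union> (F - A)) = sum f (A - F) + sum f (F - A)"
    using assms by (intro sum.union_disjoint) auto
  ultimately show ?thesis
    by (simp add: Int_commute)
qed

text \<open>Move the origin of the cube to the point \<open>A\<close>, which only row
  \<open>i\<close> covers. Among coordinates whose toggling shifts row \<open>i\<close> in one fixed
  direction, toggling any nonempty set leaves hyperplane \<open>i\<close>, so the other rows cover
  all these points but not \<open>A\<close>; hence there are at most \<open>card I - 1\<close> such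
  coordinates. The two directions exhaust the support of row \<open>i\<close>.\<close>

lemma card_support_le:
  fixes v :: "'i \<Rightarrow> 'c \<Rightarrow> real" and \<mu> :: "'i \<Rightarrow> real"
  assumes fin: "finite I" "finite N" and i: "i \<in> I" and A: "A \<subseteq> N"
    and cover: "\<And>A. A \<subseteq> N \<Longrightarrow> \<exists>i\<in>I. sum (v i) A = \<mu> i"
    and on: "sum (v i) A = \<mu> i"
    and off: "\<And>j. j \<in> I - {i} \<Longrightarrow> sum (v j) A \<noteq> \<mu> j"
  shows "card {c \<in> N. v i c \<noteq> 0} \<le> 2 * card I"
proof -
  \<comment> \<open>With this sign, \<open>s c * v i c\<close> is the change of row \<open>i\<close>
    when membership of \<open>c\<close> in \<open>A\<close> is toggled.\<close>
  define s :: "'c \<Rightarrow> real" where "s c = (if c \<in> A then -1 else 1)" for c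
  have finA: "finite A" using A fin finite_subset by auto
  have *: "card U \<le> card (I - {i})"
    if U: "U \<subseteq> N" and leave: "\<And>F. F \<subseteq> U \<Longrightarrow> F \<noteq> {} \<Longrightarrow> (\<Sum>c\<in>F. s c * v i c) \<noteq> 0" for U
  proof (rule card_le_of_covering_all_but_one
      [where \<beta> = "\<lambda>j. sum (v j) A - \<mu> j" and \<alpha> = "\<lambda>j c. s c * v j c"])
    fix F assume F: "F \<subseteq> U" "F \<noteq> {}"
    have "finite F" using F U fin by (meson finite_subset)
    have symd: "sum (v j) (A - F \<union> (F - A)) = sum (v j) A + (\<Sum>c\<in>F. s c * v j c)" for j
      unfolding s_def using finA \<open>finite F\<close> by (rule sum_symdiff)
    obtain j where j: "j \<in> I" "sum (v j) (A - F \<union> (F - A)) = \<mu> j"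
      using cover[of "A - F \<union> (F - A)"] A F U by blast
    have "j \<noteq> i" using leave[OF F] j symd[of j] on by auto
    then show "\<exists>j\<in>I - {i}. sum (v j) A - \<mu> j + (\<Sum>c\<in>F. s c * v j c) = 0"
      using j symd[of j] by (intro bexI[of _ j]) auto
  qed (use fin U off finite_subset in auto)
  let ?U = "{c \<in> N. s c * v i c > 0}" and ?D = "{c \<in> N. s c * v i c < 0}"
  have "card ?U \<le> card (I - {i})"
  proof (rule *)
    fix F assume F: "F \<subseteq> ?U" "F \<noteq> {}"
    then have "finite F" using fin by (auto intro: finite_subset)
    then have "(\<Sum>c\<in>F. s c * v i c) > 0" using F by (intro sum_pos) auto
    then show "(\<Sum>c\<in>F. s c * v i c) \<noteq> 0" by simp
  qed auto
  moreover have "card ?D \<le> card (I - {i})"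
  proof (rule *)
    fix F assume F: "F \<subseteq> ?D" "F \<noteq> {}"
    then have "finite F" using fin by (auto intro: finite_subset)
    then have "(\<Sum>c\<in>F. - (s c * v i c)) > 0" using F by (intro sum_pos) auto
    then show "(\<Sum>c\<in>F. s c * v i c) \<noteq> 0" by (simp add: sum_negf)
  qed auto
  moreover have "{c \<in> N. v i c \<noteq> 0} = ?U \<union> ?D"
    by (auto simp: s_def)
  moreover have "card (?U \<union> ?D) \<le> card ?U + card ?D"
    by (rule card_Un_le)
  moreover have "card (I - {i}) \<le> card I"
    using fin by (simp add: card_mono)
  ultimately show ?thesis by simp
qed

section \<open>Bang's lemma\<close>

text \<open>Flipping a single sign cannot increase the quadratic form at its maximum.\<close>

lemma Bang_signs:
  fixes M :: "'i \<Rightarrow> 'i \<Rightarrow> real" and \<mu> :: "'i \<Rightarrow> real"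
  assumes fin: "finite I" and \<theta>: "\<theta> > 0"
    and sym: "\<And>i j. M i j = M j i" and diag: "\<And>i. i \<in> I \<Longrightarrow> M i i = 1"
  obtains \<epsilon> :: "'i \<Rightarrow> real"
  where "\<And>i. i \<in> I \<Longrightarrow> \<bar>\<epsilon> i\<bar> = 1"
    and "\<And>i. i \<in> I \<Longrightarrow> \<theta> \<le> \<bar>(\<Sum>j\<in>I. M i j * (\<theta> * \<epsilon> j)) - \<mu> i\<bar>"
proof -
  define F where "F \<epsilon> = \<theta> * (\<Sum>i\<in>I. \<Sum>j\<in>I. M i j * \<epsilon> i * \<epsilon> j) - 2 * (\<Sum>i\<in>I. \<epsilon> i * \<mu> i)"
    for \<epsilon> :: "'i \<Rightarrow> real"
  let ?S = "PiE I (\<lambda>_. {-1, 1::real})"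
  have "finite ?S" using fin by (intro finite_PiE) auto
  moreover have "?S \<noteq> {}" by (auto simp: PiE_eq_empty_iff)
  ultimately have "Max (F ` ?S) \<in> F ` ?S" by (intro Max_in) auto
  then obtain \<epsilon> where \<epsilon>: "\<epsilon> \<in> ?S" "F \<epsilon> = Max (F ` ?S)" by auto
  have max: "F \<epsilon>' \<le> F \<epsilon>" if "\<epsilon>' \<in> ?S" for \<epsilon>'
    using that \<open>finite ?S\<close> \<epsilon>(2) by simp
  have "\<theta> \<le> \<bar>(\<Sum>j\<in>I. M i j * (\<theta> * \<epsilon> j)) - \<mu> i\<bar>" if i: "i \<in> I" for i
  proof -
    let ?J = "I - {i}"
    define X where "X = (\<Sum>j\<in>?J. M i j * \<epsilon> j)"
    have expand: "F \<eta> = \<theta> * (\<eta> i * \<eta> i + 2 * \<eta> i * (\<Sum>j\<in>?J. M i j * \<eta> j)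
         + (\<Sum>a\<in>?J. \<Sum>b\<in>?J. M a b * \<eta> a * \<eta> b)) - 2 * (\<eta> i * \<mu> i + (\<Sum>j\<in>?J. \<eta> j * \<mu> j))" for \<eta>
    proof -
      have "(\<Sum>a\<in>I. \<Sum>b\<in>I. M a b * \<eta> a * \<eta> b) =
          (\<Sum>b\<in>I. M i b * \<eta> i * \<eta> b) + (\<Sum>a\<in>?J. \<Sum>b\<in>I. M a b * \<eta> a * \<eta> b)"
        using fin i by (rule sum.remove)
      also have "(\<Sum>b\<in>I. M i b * \<eta> i * \<eta> b) = M i i * \<eta> i * \<eta> i + (\<Sum>b\<in>?J. M i b * \<eta> i * \<eta> b)"
        using fin i by (rule sum.remove)
      also have "(\<Sum>a\<in>?J. \<Sum>b\<in>I. M a b * \<eta> a * \<eta> b) =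
          (\<Sum>a\<in>?J. M a i * \<eta> a * \<eta> i + (\<Sum>b\<in>?J. M a b * \<eta> a * \<eta> b))"
        using fin i by (intro sum.cong refl sum.remove)
      also have "\<dots> = (\<Sum>a\<in>?J. M i a * \<eta> i * \<eta> a) + (\<Sum>a\<in>?J. \<Sum>b\<in>?J. M a b * \<eta> a * \<eta> b)"
        unfolding sum.distrib
        by (intro arg_cong2[of _ _ _ _ "(+)"] refl sum.cong) (simp add: sym[of _ i])
      also have "(\<Sum>a\<in>?J. M i a * \<eta> i * \<eta> a) = \<eta> i * (\<Sum>j\<in>?J. M i j * \<eta> j)"
        by (simp add: sum_distrib_left ac_simps)
      finally show ?thesis
        unfolding F_def using diag[OF i] sum.remove[OF fin i, of "\<lambda>i. \<eta> i * \<mu> i"] by simp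
    qed
    have sgn: "\<epsilon> i = 1 \<or> \<epsilon> i = -1" using \<epsilon> i by auto
    let ?\<eta> = "\<epsilon>(i := - \<epsilon> i)"
    have "?\<eta> \<in> ?S" using \<epsilon> i by (auto simp: PiE_iff extensional_def)
    then have "F ?\<eta> \<le> F \<epsilon>" by (rule max)
    moreover have "(\<Sum>j\<in>?J. M i j * ?\<eta> j) = X" "(\<Sum>j\<in>?J. ?\<eta> j * \<mu> j) = (\<Sum>j\<in>?J. \<epsilon> j * \<mu> j)"
      "(\<Sum>a\<in>?J. \<Sum>b\<in>?J. M a b * ?\<eta> a * ?\<eta> b) = (\<Sum>a\<in>?J. \<Sum>b\<in>?J. M a b * \<epsilon> a * \<epsilon> b)"
      unfolding X_def by (auto intro!: sum.cong)
    \<comment> \<open>The flip leaves the diagonal term alone and changes \<open>F\<close> by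
      \<open>-4 * \<epsilon> i * (\<theta> * X - \<mu> i)\<close>. So
      \<open>\<theta> * \<epsilon> i\<close> and \<open>\<theta> * X - \<mu> i\<close> never have
      opposite signs, and their sum has modulus at least \<open>\<theta>\<close>.\<close>
    ultimately have "0 \<le> \<epsilon> i * (\<theta> * X - \<mu> i)"
      unfolding expand X_def[symmetric] by (simp add: algebra_simps)
    moreover have "(\<Sum>j\<in>I. M i j * (\<theta> * \<epsilon> j)) = \<theta> * \<epsilon> i + \<theta> * X"
      unfolding X_def using sum.remove[OF fin i, of "\<lambda>j. M i j * (\<theta> * \<epsilon> j)"] diag[OF i]
      by (simp add: sum_distrib_left ac_simps)
    ultimately show ?thesis
      using sgn \<theta> by auto
  qed
  moreover have "\<bar>\<epsilon> i\<bar> = 1" if "i \<in> I" for i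
    using \<epsilon> that by (auto simp: PiE_iff)
  ultimately show thesis using that by blast
qed

section \<open>Dyadic families\<close>

text \<open>Sorted by absolute value, the entries at least double from each one to the next. The
  pairwise form needs no enumeration and passes to subsets at once.\<close>

definition dyadic :: "('c \<Rightarrow> real) \<Rightarrow> 'c set \<Rightarrow> bool" where
  "dyadic a Z \<longleftrightarrow> (\<forall>c\<in>Z. a c \<noteq> 0) \<and>
     (\<forall>c\<in>Z. \<forall>d\<in>Z. c \<noteq> d \<longrightarrow> 2 * \<bar>a c\<bar> \<le> \<bar>a d\<bar> \<or> 2 * \<bar>a d\<bar> \<le> \<bar>a c\<bar>)"

lemma dyadic_empty [simp]: "dyadic a {}"
  by (simp add: dyadic_def)

lemma dyadic_subset: "dyadic a Z \<Longrightarrow> Y \<subseteq> Z \<Longrightarrow> dyadic a Y"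
  unfolding dyadic_def by (meson subsetD)

lemma dyadic_insertD:
  assumes "dyadic a (insert x Z)" "x \<notin> Z" "y \<in> Z" "\<bar>a y\<bar> \<le> \<bar>a x\<bar>"
  shows "2 * \<bar>a y\<bar> \<le> \<bar>a x\<bar>"
proof -
  have "x \<noteq> y" using assms by blast
  then have "a x \<noteq> 0" "2 * \<bar>a x\<bar> \<le> \<bar>a y\<bar> \<or> 2 * \<bar>a y\<bar> \<le> \<bar>a x\<bar>"
    using assms(1,3) unfolding dyadic_def by simp_all
  then show ?thesis using assms(4) by auto
qed

text \<open>A geometric series: the largest entry \<open>x\<close> is inserted last, the others sum
  to less than \<open>\<bar>a x\<bar>\<close> by induction, and
  \<open>2 * \<bar>a x\<bar> \<le> b\<close>.\<close>

lemma dyadic_sum_abs_less: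
  fixes a :: "'c \<Rightarrow> real"
  assumes "finite Z" "dyadic a Z" "b > 0" "\<And>c. c \<in> Z \<Longrightarrow> 2 * \<bar>a c\<bar> \<le> b"
  shows "(\<Sum>c\<in>Z. \<bar>a c\<bar>) < b"
  using assms
proof (induction Z arbitrary: b rule: finite_ranking_induct[where f = "\<lambda>c. \<bar>a c\<bar>"])
  case empty
  then show ?case by simp
next
  case (insert x Z)
  show ?case
  proof (cases "x \<in> Z")
    case True
    then show ?thesis using insert by (simp add: insert_absorb)
  next
    case False
    have "(\<Sum>c\<in>Z. \<bar>a c\<bar>) < \<bar>a x\<bar>"
    proof (rule insert.IH)
      show "dyadic a Z" using insert.prems dyadic_subset by blast
      show "\<bar>a x\<bar> > 0" using insert.prems by (auto simp: dyadic_def)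
      show "2 * \<bar>a c\<bar> \<le> \<bar>a x\<bar>" if "c \<in> Z" for c
        using dyadic_insertD[OF insert.prems(1) False that] insert.hyps that by simp
    qed
    moreover have "2 * \<bar>a x\<bar> \<le> b" using insert.prems by simp
    ultimately show ?thesis using False insert.hyps by simp
  qed
qed

text \<open>The largest entry exceeds the sum of the absolute values of all the others, so two sets
  with equal sums both contain it or both omit it. It is then dropped and induction applies.\<close>

lemma dyadic_subset_sums_distinct:
  fixes a :: "'c \<Rightarrow> real"
  assumes "finite Z" "dyadic a Z" "A \<subseteq> Z" "B \<subseteq> Z" "sum a A = sum a B"
  shows "A = B"
  using assms
proof (induction Z arbitrary: A B rule: finite_ranking_induct[where f = "\<lambda>c. \<bar>a c\<bar>"])
  case empty
  then show ?case by simp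
next
  case (insert x Z)
  show ?case
  proof (cases "x \<in> Z")
    case True
    then show ?thesis using insert by (simp add: insert_absorb)
  next
    case False
    have dy: "dyadic a Z" using insert.prems dyadic_subset by blast
    have small: "(\<Sum>c\<in>Z. \<bar>a c\<bar>) < \<bar>a x\<bar>"
    proof (rule dyadic_sum_abs_less[OF insert.hyps(1) dy])
      show "\<bar>a x\<bar> > 0" using insert.prems by (auto simp: dyadic_def)
      show "2 * \<bar>a c\<bar> \<le> \<bar>a x\<bar>" if "c \<in> Z" for c
        using dyadic_insertD[OF insert.prems(1) False that] insert.hyps that by simp
    qed
    have no: False if A: "A \<subseteq> Z" and B: "B \<subseteq> Z" and eq: "sum a (insert x A) = sum a B" for A B
    proof -
      have fin: "finite A" "finite B" using A B insert.hyps(1) by (auto intro: finite_subset)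
      have "a x = sum a B - sum a A" using eq fin A False by (subst (asm) sum.insert) auto
      also have "\<dots> = sum a (B - A) - sum a (A - B)"
        using sum.Int_Diff[OF fin(1), of a B] sum.Int_Diff[OF fin(2), of a A]
        by (simp add: Int_commute)
      finally have "\<bar>a x\<bar> \<le> \<bar>sum a (B - A)\<bar> + \<bar>sum a (A - B)\<bar>" by linarith
      also have "\<dots> \<le> (\<Sum>c\<in>B - A. \<bar>a c\<bar>) + (\<Sum>c\<in>A - B. \<bar>a c\<bar>)"
        by (intro add_mono sum_abs)
      also have "\<dots> = (\<Sum>c\<in>(B - A) \<union> (A - B). \<bar>a c\<bar>)"
        using fin by (intro sum.union_disjoint[symmetric]) auto
      also have "\<dots> \<le> (\<Sum>c\<in>Z. \<bar>a c\<bar>)"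
        using A B insert.hyps by (intro sum_mono2) auto
      finally show False using small by simp
    qed
    have split: "X - {x} \<subseteq> Z" if "X \<subseteq> insert x Z" for X using that by auto
    have fin: "finite A" "finite B" using insert.prems insert.hyps(1) by (auto intro: finite_subset)
    consider "x \<in> A" "x \<in> B" | "x \<notin> A" "x \<notin> B" | "x \<in> A" "x \<notin> B" | "x \<notin> A" "x \<in> B" by blast
    then show ?thesis
    proof cases
      case 1
      have "sum a (A - {x}) = sum a (B - {x})"
        using 1 fin insert.prems by (simp add: sum_diff1)
      then have "A - {x} = B - {x}"
        using insert.prems by (intro insert.IH dy split)
      then show ?thesis using 1 by blast
    next
      case 2
      then show ?thesis using insert.prems by (intro insert.IH dy) auto
    next
      case 3
      then show ?thesis using no[of "A - {x}" B] insert.prems by (auto simp: insert_absorb)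
    next
      case 4
      then show ?thesis using no[of "B - {x}" A] insert.prems by (auto simp: insert_absorb)
    qed
  qed
qed

section \<open>Random subsets\<close>

text \<open>Probability that a random subset of \<open>R\<close>, containing each \<open>c\<close> independently with
  probability \<open>q c\<close>, satisfies \<open>P\<close>.\<close>

definition subset_weight :: "('c \<Rightarrow> real) \<Rightarrow> 'c set \<Rightarrow> 'c set \<Rightarrow> real" where
  "subset_weight q R A = (\<Prod>c\<in>A. q c) * (\<Prod>c\<in>R - A. 1 - q c)"

definition subset_prob :: "('c \<Rightarrow> real) \<Rightarrow> 'c set \<Rightarrow> ('c set \<Rightarrow> bool) \<Rightarrow> real" where
  "subset_prob q R P = (\<Sum>A\<in>Pow R. if P A then subset_weight q R A else 0)"

lemma subset_weight_nonneg:
  assumes "\<And>c. c \<in> R \<Longrightarrow> 0 \<le> q c \<and> q c \<le> 1" "A \<subseteq> R"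
  shows "0 \<le> subset_weight q R A"
proof -
  have "0 \<le> q c" if "c \<in> A" for c using assms that by blast
  moreover have "0 \<le> 1 - q c" if "c \<in> R - A" for c using assms(1)[of c] that by simp
  ultimately show ?thesis
    unfolding subset_weight_def by (intro mult_nonneg_nonneg prod_nonneg)
qed

lemma sum_subset_weight:
  assumes "finite R"
  shows "sum (subset_weight q R) (Pow R) = 1"
proof -
  have "(\<Prod>c\<in>R. q c + (1 - q c)) = sum (subset_weight q R) (Pow R)"
    unfolding subset_weight_def using assms by (rule prod_add)
  then show ?thesis by simp
qed

text \<open>The union bound.\<close>

lemma exists_subset_avoiding:
  assumes fin: "finite R" "finite I" and q: "\<And>c. c \<in> R \<Longrightarrow> 0 \<le> q c \<and> q c \<le> 1"
    and small: "(\<Sum>i\<in>I. subset_prob q R (P i)) < 1"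
  obtains A where "A \<subseteq> R" "\<And>i. i \<in> I \<Longrightarrow> \<not> P i A"
proof -
  have "\<exists>A\<subseteq>R. \<forall>i\<in>I. \<not> P i A"
  proof (rule ccontr)
    assume neg: "\<not> ?thesis"
    have "1 = sum (subset_weight q R) (Pow R)"
      using fin by (simp add: sum_subset_weight)
    also have "\<dots> \<le> (\<Sum>A\<in>Pow R. \<Sum>i\<in>I. if P i A then subset_weight q R A else 0)"
    proof (rule sum_mono)
      fix A assume A: "A \<in> Pow R"
      then obtain i where i: "i \<in> I" "P i A" using neg by auto
      have "(\<Sum>i\<in>{i}. if P i A then subset_weight q R A else 0) \<le>
          (\<Sum>i\<in>I. if P i A then subset_weight q R A else 0)"
        using fin i A subset_weight_nonneg[OF q] by (intro sum_mono2) auto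
      then show "subset_weight q R A \<le> (\<Sum>i\<in>I. if P i A then subset_weight q R A else 0)"
        using i by simp
    qed
    also have "\<dots> = (\<Sum>i\<in>I. subset_prob q R (P i))"
      unfolding subset_prob_def by (rule sum.swap)
    finally show False using small by simp
  qed
  then show thesis using that by blast
qed

text \<open>Conditioning on the choice at \<open>x\<close>.\<close>

lemma subset_prob_insert:
  assumes "finite R" "x \<notin> R"
  shows "subset_prob q (insert x R) P =
    q x * subset_prob q R (\<lambda>A. P (insert x A)) + (1 - q x) * subset_prob q R P"
proof -
  let ?f = "\<lambda>R A. if P A then subset_weight q R A else 0"
  have w: "subset_weight q (insert x R) (insert x A) = q x * subset_weight q R A"
    "subset_weight q (insert x R) A = (1 - q x) * subset_weight q R A" if "A \<subseteq> R" for A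
  proof -
    have "finite A" "x \<notin> A" using that assms finite_subset by auto
    then show "subset_weight q (insert x R) (insert x A) = q x * subset_weight q R A"
      using assms by (simp add: subset_weight_def insert_Diff_if)
    show "subset_weight q (insert x R) A = (1 - q x) * subset_weight q R A"
      using \<open>x \<notin> A\<close> assms by (simp add: subset_weight_def insert_Diff_if)
  qed
  have "subset_prob q (insert x R) P =
      (\<Sum>A\<in>Pow R. ?f (insert x R) A) + (\<Sum>A\<in>insert x ` Pow R. ?f (insert x R) A)"
    unfolding subset_prob_def Pow_insert using assms by (intro sum.union_disjoint) auto
  also have "(\<Sum>A\<in>insert x ` Pow R. ?f (insert x R) A) = (\<Sum>A\<in>Pow R. ?f (insert x R) (insert x A))"
    using assms by (intro sum.reindex_cong[OF _ refl refl] inj_onI) (metis PowD insert_ident subset_iff)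
  also have "\<dots> = q x * subset_prob q R (\<lambda>A. P (insert x A))"
    unfolding subset_prob_def sum_distrib_left by (intro sum.cong) (auto simp: w)
  also have "(\<Sum>A\<in>Pow R. ?f (insert x R) A) = (1 - q x) * subset_prob q R P"
    unfolding subset_prob_def sum_distrib_left by (intro sum.cong) (auto simp: w)
  finally show ?thesis by simp
qed

lemma subset_prob_cong:
  "(\<And>A. A \<subseteq> R \<Longrightarrow> P A \<longleftrightarrow> Q A) \<Longrightarrow> subset_prob q R P = subset_prob q R Q"
  unfolding subset_prob_def by (rule sum.cong) simp_all

text \<open>Once the choices outside \<open>Z\<close> are made, at most one subset of
  \<open>Z\<close> produces the required sum, and any single subset of \<open>Z\<close> has weight
  at most \<open>(3 / 4) ^ card Z\<close>.\<close>

lemma subset_prob_sum_eq_dyadic_le: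
  fixes a :: "'c \<Rightarrow> real"
  assumes fin: "finite R" and Z: "Z \<subseteq> R" "dyadic a Z"
    and q: "\<And>c. c \<in> R \<Longrightarrow> 1 / 4 \<le> q c \<and> q c \<le> 3 / 4"
  shows "subset_prob q R (\<lambda>A. sum a A = \<mu>) \<le> (3 / 4) ^ card Z"
proof -
  have finZ: "finite Z" using Z fin finite_subset by auto
  have base: "subset_prob q Z (\<lambda>A. sum a A = \<mu>) \<le> (3 / 4) ^ card Z" for \<mu>
  proof -
    have qZ: "0 \<le> q c" "q c \<le> 3 / 4" "1 - q c \<le> 3 / 4" "q c \<le> 1" if "c \<in> Z" for c
      using q[of c] Z(1) that by auto
    have weight: "subset_weight q Z A \<le> (3 / 4) ^ card Z" if A: "A \<subseteq> Z" for A
    proof -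
      have "(\<Prod>c\<in>A. q c) \<le> (\<Prod>c\<in>A. 3 / 4)" "(\<Prod>c\<in>Z - A. 1 - q c) \<le> (\<Prod>c\<in>Z - A. 3 / 4)"
        using qZ A by (intro prod_mono; force)+
      then have "subset_weight q Z A \<le> (\<Prod>c\<in>A. 3 / 4) * (\<Prod>c\<in>Z - A. 3 / 4)"
        unfolding subset_weight_def using qZ A by (intro mult_mono prod_nonneg) auto
      also have "\<dots> = (\<Prod>c\<in>Z. 3 / 4)"
        using prod.subset_diff[OF A finZ, of "\<lambda>_. 3 / 4 :: real"] by (simp only: mult.commute)
      finally show ?thesis by simp
    qed
    show ?thesis
    proof (cases "\<exists>A\<subseteq>Z. sum a A = \<mu>")
      case True
      then obtain A where A: "A \<subseteq> Z" "sum a A = \<mu>" by blast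
      have "subset_prob q Z (\<lambda>A. sum a A = \<mu>) = subset_prob q Z (\<lambda>B. B = A)"
        using dyadic_subset_sums_distinct[OF finZ Z(2)] A by (intro subset_prob_cong) metis
      also have "\<dots> = subset_weight q Z A"
        unfolding subset_prob_def using A finZ by simp
      finally show ?thesis using weight A by simp
    next
      case False
      then have "subset_prob q Z (\<lambda>A. sum a A = \<mu>) = 0"
        unfolding subset_prob_def by (intro sum.neutral) auto
      then show ?thesis by simp
    qed
  qed
  \<comment> \<open>Coordinates outside \<open>Z\<close> are added one at a time. Choosing
    \<open>x\<close> only shifts the target by \<open>a x\<close>, so a bound valid for every
    \<open>\<mu>\<close> survives averaging over that choice.\<close>
  have "subset_prob q (Z \<union> Y) (\<lambda>A. sum a A = \<mu>) \<le> (3 / 4) ^ card Z"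
    if "finite Y" "Y \<subseteq> R - Z" for Y
    using that
  proof (induction Y arbitrary: \<mu> rule: finite_induct)
    case empty
    then show ?case using base by simp
  next
    case (insert x Y)
    have x: "x \<notin> Z \<union> Y" "x \<in> R" and finZY: "finite (Z \<union> Y)" using insert finZ by auto
    have "subset_prob q (Z \<union> insert x Y) (\<lambda>A. sum a A = \<mu>) =
      q x * subset_prob q (Z \<union> Y) (\<lambda>A. sum a (insert x A) = \<mu>)
      + (1 - q x) * subset_prob q (Z \<union> Y) (\<lambda>A. sum a A = \<mu>)"
      using subset_prob_insert[OF finZY x(1)] by simp
    also have "subset_prob q (Z \<union> Y) (\<lambda>A. sum a (insert x A) = \<mu>) =
        subset_prob q (Z \<union> Y) (\<lambda>A. sum a A = \<mu> - a x)"
    proof (rule subset_prob_cong)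
      fix A assume "A \<subseteq> Z \<union> Y"
      then have "finite A" "x \<notin> A" using finZY x finite_subset by auto
      then show "sum a (insert x A) = \<mu> \<longleftrightarrow> sum a A = \<mu> - a x" by auto
    qed
    also have "q x * \<dots> + (1 - q x) * subset_prob q (Z \<union> Y) (\<lambda>A. sum a A = \<mu>)
        \<le> q x * (3 / 4) ^ card Z + (1 - q x) * (3 / 4) ^ card Z"
      using insert q[OF x(2)] by (intro add_mono mult_left_mono insert.IH) auto
    finally show ?case by (simp add: algebra_simps)
  qed
  from this[of "R - Z"] show ?thesis
    using fin Z by (simp add: Un_absorb1)
qed

section \<open>Hoeffding's inequality for random subsets\<close>

text \<open>Hoeffding's lemma for a centred Bernoulli variable. Negative \<open>h\<close> reduces to
  positive \<open>h\<close> by exchanging the two outcomes, that is, \<open>p\<close> with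
  \<open>1 - p\<close>.\<close>

lemma Hoeffding_bernoulli:
  fixes h p :: real
  assumes "0 \<le> p" "p \<le> 1"
  shows "p * exp (h * (1 - p)) + (1 - p) * exp (- h * p) \<le> exp (h\<^sup>2 / 8)"
proof -
  have *: "p * exp (h * (1 - p)) + (1 - p) * exp (- h * p) \<le> exp (h\<^sup>2 / 8)"
    if p: "0 \<le> p" "p \<le> 1" and h: "h \<ge> 0" for h p :: real
  proof -
    have pos: "1 + p * (exp h - 1) > 0"
      using p h by (intro add_pos_nonneg mult_nonneg_nonneg) auto
    have "p * exp (h * (1 - p)) + (1 - p) * exp (- h * p) = exp (- h * p) * (1 + p * (exp h - 1))"
      by (simp add: algebra_simps exp_diff exp_minus divide_inverse)
    also have "\<dots> = exp (- h * p + ln (1 + p * (exp h - 1)))"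
      using pos by (subst exp_add) simp
    also have "\<dots> \<le> exp (h\<^sup>2 / 8)"
      using Hoeffdings_lemma_aux[OF h p(1)] by simp
    finally show ?thesis .
  qed
  show ?thesis
  proof (cases "h \<ge> 0")
    case True
    then show ?thesis using * assms by blast
  next
    case False
    then show ?thesis using *[of "1 - p" "- h"] assms by (simp add: algebra_simps)
  qed
qed

text \<open>Chernoff's method: the event is dominated by an exponential of the deviation, whose mean
  factors over the coordinates.\<close>

lemma subset_prob_upper_tail:
  fixes w :: "'c \<Rightarrow> real"
  assumes fin: "finite R" and q: "\<And>c. c \<in> R \<Longrightarrow> 0 \<le> q c \<and> q c \<le> 1"
    and norm: "(\<Sum>c\<in>R. (w c)\<^sup>2) \<le> 1" and \<theta>: "\<theta> > 0"
  shows "subset_prob q R (\<lambda>A. \<theta> \<le> sum w A - (\<Sum>c\<in>R. q c * w c)) \<le> exp (- 2 * \<theta>\<^sup>2)"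
proof -
  \<comment> \<open>This value minimises \<open>- s * \<theta> + s^2 / 8\<close>.\<close>
  define s where "s = 4 * \<theta>"
  let ?f = "\<lambda>c. q c * exp (s * w c * (1 - q c))" and ?g = "\<lambda>c. (1 - q c) * exp (- (s * w c) * q c)"
  have "subset_prob q R (\<lambda>A. \<theta> \<le> sum w A - (\<Sum>c\<in>R. q c * w c)) \<le>
      (\<Sum>A\<in>Pow R. exp (- s * \<theta>) * (prod ?f A * prod ?g (R - A)))"
    unfolding subset_prob_def
  proof (rule sum_mono)
    fix A assume A: "A \<in> Pow R"
    then have finA: "finite A" using fin finite_subset by auto
    have "(\<Sum>c\<in>R. q c * w c) = (\<Sum>c\<in>A. q c * w c) + (\<Sum>c\<in>R - A. q c * w c)"
      using A fin by (simp add: sum.subset_diff add.commute)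
    then have "sum w A - (\<Sum>c\<in>R. q c * w c) = (\<Sum>c\<in>A. w c * (1 - q c)) + (\<Sum>c\<in>R - A. - (w c * q c))"
      by (simp add: sum_negf sum_subtractf right_diff_distrib mult.commute)
    then have "s * (sum w A - (\<Sum>c\<in>R. q c * w c)) =
        (\<Sum>c\<in>A. s * w c * (1 - q c)) + (\<Sum>c\<in>R - A. - (s * w c) * q c)"
      by (simp add: distrib_left sum_distrib_left mult.assoc)
    then have "exp (s * (sum w A - (\<Sum>c\<in>R. q c * w c))) =
        (\<Prod>c\<in>A. exp (s * w c * (1 - q c))) * (\<Prod>c\<in>R - A. exp (- (s * w c) * q c))"
      using fin finA by (simp add: exp_add exp_sum)
    then have eq: "exp (- s * \<theta>) * (prod ?f A * prod ?g (R - A)) =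
        exp (s * (sum w A - (\<Sum>c\<in>R. q c * w c) - \<theta>)) * subset_weight q R A"
      by (simp add: prod.distrib subset_weight_def right_diff_distrib exp_diff exp_minus divide_inverse ac_simps)
    have nn: "0 \<le> subset_weight q R A" using subset_weight_nonneg[OF q] A by auto
    show "(if \<theta> \<le> sum w A - (\<Sum>c\<in>R. q c * w c) then subset_weight q R A else 0) \<le>
        exp (- s * \<theta>) * (prod ?f A * prod ?g (R - A))"
    proof (cases "\<theta> \<le> sum w A - (\<Sum>c\<in>R. q c * w c)")
      case True
      then have "1 \<le> exp (s * (sum w A - (\<Sum>c\<in>R. q c * w c) - \<theta>))"
        using \<theta> by (simp add: s_def)
      then show ?thesis
        unfolding eq using True nn mult_right_mono[of 1 _ "subset_weight q R A"] by simp
    next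
      case False
      then show ?thesis unfolding eq using nn by simp
    qed
  qed
  also have "\<dots> = exp (- s * \<theta>) * (\<Prod>c\<in>R. ?f c + ?g c)"
    unfolding prod_add[OF fin] sum_distrib_left ..
  also have "\<dots> \<le> exp (- s * \<theta>) * (\<Prod>c\<in>R. exp ((s * w c)\<^sup>2 / 8))"
  proof (intro mult_left_mono prod_mono conjI)
    fix c assume "c \<in> R"
    then show "?f c + ?g c \<le> exp ((s * w c)\<^sup>2 / 8)"
      using Hoeffding_bernoulli[of "q c" "s * w c"] q by simp
    show "0 \<le> ?f c + ?g c" using q \<open>c \<in> R\<close> by (intro add_nonneg_nonneg mult_nonneg_nonneg) auto
  qed auto
  also have "\<dots> = exp (- s * \<theta> + s\<^sup>2 / 8 * (\<Sum>c\<in>R. (w c)\<^sup>2))"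
    unfolding exp_add using fin by (simp add: exp_sum sum_distrib_left power_mult_distrib)
  also have "\<dots> \<le> exp (- s * \<theta> + s\<^sup>2 / 8 * 1)"
    using norm by (subst exp_le_cancel_iff, intro add_left_mono mult_left_mono) auto
  also have "- s * \<theta> + s\<^sup>2 / 8 * 1 = - 2 * \<theta>\<^sup>2"
    by (simp add: s_def power2_eq_square)
  finally show ?thesis .
qed

lemma subset_prob_le_add:
  assumes "\<And>c. c \<in> R \<Longrightarrow> 0 \<le> q c \<and> q c \<le> 1" "\<And>A. A \<subseteq> R \<Longrightarrow> P A \<Longrightarrow> Q A \<or> Q' A"
  shows "subset_prob q R P \<le> subset_prob q R Q + subset_prob q R Q'"
  unfolding subset_prob_def sum.distrib[symmetric]
proof (rule sum_mono)
  fix A assume "A \<in> Pow R"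
  then show "(if P A then subset_weight q R A else 0) \<le>
      (if Q A then subset_weight q R A else 0) + (if Q' A then subset_weight q R A else 0)"
    using assms(2)[of A] subset_weight_nonneg[of R q A] assms(1) by auto
qed

text \<open>Hitting \<open>\<mu>\<close> forces a deviation of at least \<open>\<theta>\<close> from
  the mean in one of the two directions; the lower tail is the upper tail of
  \<open>- w\<close>.\<close>

lemma subset_prob_sum_eq_le_Hoeffding:
  fixes w :: "'c \<Rightarrow> real"
  assumes fin: "finite R" and q: "\<And>c. c \<in> R \<Longrightarrow> 0 \<le> q c \<and> q c \<le> 1"
    and norm: "(\<Sum>c\<in>R. (w c)\<^sup>2) \<le> 1" and \<theta>: "\<theta> > 0"
    and far: "\<theta> \<le> \<bar>(\<Sum>c\<in>R. q c * w c) - \<mu>\<bar>"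
  shows "subset_prob q R (\<lambda>A. sum w A = \<mu>) \<le> 2 * exp (- 2 * \<theta>\<^sup>2)"
proof -
  have "subset_prob q R (\<lambda>A. sum w A = \<mu>) \<le>
      subset_prob q R (\<lambda>A. \<theta> \<le> sum w A - (\<Sum>c\<in>R. q c * w c)) +
      subset_prob q R (\<lambda>A. \<theta> \<le> (\<Sum>c\<in>A. - w c) - (\<Sum>c\<in>R. q c * - w c))"
    using far by (intro subset_prob_le_add q) (auto simp: sum_negf)
  also have "\<dots> \<le> exp (- 2 * \<theta>\<^sup>2) + exp (- 2 * \<theta>\<^sup>2)"
    using assms by (intro add_mono subset_prob_upper_tail) auto
  finally show ?thesis by simp
qed

section \<open>Removing columns\<close>

text \<open>Entries and norm are both restricted to \<open>R\<close>, so deleting columns can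
  destroy this property as well as create it. For this reason \<open>thinning\<close> uses a
  potential instead of preserving spread rows.\<close>

definition spread :: "real \<Rightarrow> ('c \<Rightarrow> real) \<Rightarrow> 'c set \<Rightarrow> bool" where
  "spread \<tau> a R \<longleftrightarrow> (\<forall>c\<in>R. \<tau> * (a c)\<^sup>2 \<le> (\<Sum>d\<in>R. (a d)\<^sup>2))"

definition scales :: "('c \<Rightarrow> real) \<Rightarrow> 'c set \<Rightarrow> nat" where
  "scales a R = Max (card ` {Z. Z \<subseteq> R \<and> dyadic a Z})"

lemma card_le_scales:
  assumes "finite R" "Z \<subseteq> R" "dyadic a Z"
  shows "card Z \<le> scales a R"
  unfolding scales_def using assms by (intro Max_ge finite_imageI) auto

lemma scales_attained:
  assumes "finite R"
  obtains Z where "Z \<subseteq> R" "dyadic a Z" "card Z = scales a R"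
proof -
  have "scales a R \<in> card ` {Z. Z \<subseteq> R \<and> dyadic a Z}"
    unfolding scales_def
  proof (rule Max_in)
    show "finite (card ` {Z. Z \<subseteq> R \<and> dyadic a Z})" using assms by (intro finite_imageI) auto
    have "{} \<in> {Z. Z \<subseteq> R \<and> dyadic a Z}" by simp
    then show "card ` {Z. Z \<subseteq> R \<and> dyadic a Z} \<noteq> {}" by blast
  qed
  then show thesis using that by auto
qed

lemma scales_mono:
  assumes "finite R" "S \<subseteq> R"
  shows "scales a S \<le> scales a R"
proof -
  obtain Z where "Z \<subseteq> S" "dyadic a Z" "card Z = scales a S"
    using scales_attained[of S a] assms finite_subset by blast
  then show ?thesis using card_le_scales[of R Z a] assms by simp
qed

text \<open>\<open>T\<close> collects the entries above half of the maximum. As the row is not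
  spread, its sum of squares is below \<open>\<tau>\<close> times the squared maximum, while each
  entry in \<open>T\<close> contributes at least a quarter of the squared maximum; this bounds
  \<open>card T\<close>. A maximal entry can be put on top of any dyadic set outside
  \<open>T\<close>, so the number of scales drops.\<close>

lemma remove_top_scale:
  fixes a :: "'c \<Rightarrow> real"
  assumes fin: "finite R" and ns: "\<not> spread \<tau> a R"
  obtains T where "T \<subseteq> R" "real (card T) \<le> 4 * \<tau>" "scales a (R - T) < scales a R"
proof -
  obtain c where c: "c \<in> R" "(\<Sum>d\<in>R. (a d)\<^sup>2) < \<tau> * (a c)\<^sup>2"
    using ns unfolding spread_def by (auto simp: not_le)
  have "Max ((\<lambda>c. \<bar>a c\<bar>) ` R) \<in> (\<lambda>c. \<bar>a c\<bar>) ` R"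
    using fin c by (intro Max_in) auto
  then obtain m where m: "m \<in> R" "\<bar>a m\<bar> = Max ((\<lambda>c. \<bar>a c\<bar>) ` R)" by auto
  have max: "\<bar>a d\<bar> \<le> \<bar>a m\<bar>" if "d \<in> R" for d
    using m fin that by simp
  have ss: "0 \<le> (\<Sum>d\<in>R. (a d)\<^sup>2)" by (intro sum_nonneg) auto
  have "\<tau> > 0" using c ss by (smt (verit) mult_nonpos_nonneg zero_le_power2)
  have "(a c)\<^sup>2 \<le> (a m)\<^sup>2" using max[OF c(1)] by (simp add: abs_le_square_iff)
  then have less: "(\<Sum>d\<in>R. (a d)\<^sup>2) < \<tau> * (a m)\<^sup>2"
    using c(2) \<open>\<tau> > 0\<close> by (smt (verit) mult_left_mono)
  then have am: "a m \<noteq> 0" using ss by auto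
  define T where "T = {d \<in> R. \<bar>a m\<bar> < 2 * \<bar>a d\<bar>}"
  have "real (card T) * ((a m)\<^sup>2 / 4) = (\<Sum>d\<in>T. (a m)\<^sup>2 / 4)" by simp
  also have "\<dots> \<le> (\<Sum>d\<in>T. (a d)\<^sup>2)"
  proof (rule sum_mono)
    fix d assume "d \<in> T"
    then have "\<bar>a m\<bar> \<le> \<bar>2 * a d\<bar>" by (simp add: T_def abs_mult)
    then have "(a m)\<^sup>2 \<le> (2 * a d)\<^sup>2" by (simp add: abs_le_square_iff)
    then show "(a m)\<^sup>2 / 4 \<le> (a d)\<^sup>2" by (simp add: power_mult_distrib)
  qed
  also have "\<dots> \<le> (\<Sum>d\<in>R. (a d)\<^sup>2)" using fin by (intro sum_mono2) (auto simp: T_def)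
  finally have "real (card T) * ((a m)\<^sup>2 / 4) \<le> 4 * \<tau> * ((a m)\<^sup>2 / 4)" using less by simp
  then have card: "real (card T) \<le> 4 * \<tau>" using am by (simp add: mult_le_cancel_right)
  obtain Z where Z: "Z \<subseteq> R - T" "dyadic a Z" "card Z = scales a (R - T)"
    using scales_attained[of "R - T" a] fin by blast
  have "m \<in> T" using m am by (simp add: T_def)
  then have "m \<notin> Z" using Z by auto
  have "2 * \<bar>a d\<bar> \<le> \<bar>a m\<bar>" if "d \<in> Z" for d
    using that Z(1) by (auto simp: T_def not_less)
  then have "dyadic a (insert m Z)"
    using Z(2) am unfolding dyadic_def by auto
  then have "card (insert m Z) \<le> scales a R"
    using Z m fin by (intro card_le_scales) auto
  moreover have "finite Z" using Z fin by (meson finite_Diff finite_subset)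
  ultimately have "scales a (R - T) < scales a R" using Z(3) \<open>m \<notin> Z\<close> by simp
  with card show thesis by (intro that[of T]) (auto simp: T_def)
qed

text \<open>A row that is neither spread nor has \<open>L\<close> scales loses its top scale; since it never regains
  scales, it is treated fewer than \<open>L\<close> times, however much the other rows remove in between.\<close>

lemma thinning:
  fixes v :: "'i \<Rightarrow> 'c \<Rightarrow> real"
  assumes fin: "finite I" "finite N" and \<tau>: "\<tau> \<ge> 0"
  obtains R where "R \<subseteq> N" "real (card (N - R)) \<le> 4 * \<tau> * real (card I * L)"
    "\<And>i. i \<in> I \<Longrightarrow> spread \<tau> (v i) R \<or> L \<le> scales (v i) R"
proof -
  \<comment> \<open>Truncation at \<open>L\<close> bounds the initial potential by
    \<open>card I * L\<close>. It does not mask the drop at the treated row, which has fewer than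
    \<open>L\<close> scales.\<close>
  define \<Phi> where "\<Phi> R = (\<Sum>i\<in>I. min L (scales (v i) R))" for R
  have "\<exists>R'\<subseteq>R. real (card (R - R')) \<le> 4 * \<tau> * real (\<Phi> R) \<and>
      (\<forall>i\<in>I. spread \<tau> (v i) R' \<or> L \<le> scales (v i) R')" if "finite R" for R
    using that
  proof (induction "\<Phi> R" arbitrary: R rule: less_induct)
    case less
    show ?case
    proof (cases "\<forall>i\<in>I. spread \<tau> (v i) R \<or> L \<le> scales (v i) R")
      case True
      then show ?thesis using \<tau> by (intro exI[of _ R]) auto
    next
      case False
      then obtain i where i: "i \<in> I" "\<not> spread \<tau> (v i) R" "scales (v i) R < L"
        by (auto simp: not_le)
      obtain T where T: "T \<subseteq> R" "real (card T) \<le> 4 * \<tau>" "scales (v i) (R - T) < scales (v i) R"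
        using remove_top_scale[OF less.prems i(2)] .
      have "\<Phi> (R - T) < \<Phi> R"
        unfolding \<Phi>_def
      proof (rule sum_strict_mono_ex1)
        show "\<forall>j\<in>I. min L (scales (v j) (R - T)) \<le> min L (scales (v j) R)"
          using scales_mono[OF less.prems] by (intro ballI min.mono) auto
        show "\<exists>j\<in>I. min L (scales (v j) (R - T)) < min L (scales (v j) R)"
          using i T by (intro bexI[of _ i]) auto
      qed (rule fin)
      then obtain R' where R': "R' \<subseteq> R - T" "real (card (R - T - R')) \<le> 4 * \<tau> * real (\<Phi> (R - T))"
        "\<forall>i\<in>I. spread \<tau> (v i) R' \<or> L \<le> scales (v i) R'"
        using less.hyps[of "R - T"] less.prems by auto
      have "R - R' = T \<union> (R - T - R')" using T R' by auto
      then have "card (R - R') \<le> card T + card (R - T - R')" by (metis card_Un_le)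
      then have "real (card (R - R')) \<le> 4 * \<tau> + 4 * \<tau> * real (\<Phi> (R - T))"
        using T R' by linarith
      also have "\<dots> = 4 * \<tau> * real (\<Phi> (R - T) + 1)" by (simp add: algebra_simps)
      also have "\<dots> \<le> 4 * \<tau> * real (\<Phi> R)"
        using \<open>\<Phi> (R - T) < \<Phi> R\<close> \<tau> by (intro mult_left_mono) auto
      finally show ?thesis using R' by blast
    qed
  qed
  then obtain R where R: "R \<subseteq> N" "real (card (N - R)) \<le> 4 * \<tau> * real (\<Phi> N)"
    "\<forall>i\<in>I. spread \<tau> (v i) R \<or> L \<le> scales (v i) R"
    using fin by blast
  have "\<Phi> N \<le> (\<Sum>i\<in>I. L)" unfolding \<Phi>_def by (intro sum_mono) auto
  then have "4 * \<tau> * real (\<Phi> N) \<le> 4 * \<tau> * real (card I * L)"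
    using \<tau> by (intro mult_left_mono) (auto simp del: of_nat_mult)
  then show thesis using that R by auto
qed

section \<open>Avoiding all rows at once by a biased random subset\<close>

text \<open>Coordinates are chosen with probability \<open>1 / 2 + u c\<close>, where
  \<open>u\<close> combines the normalised spread rows with Bang's signs. This puts the mean of
  every spread row at distance at least \<open>\<theta>\<close> from its target, so Hoeffding's
  bound applies; as the bias stays within \<open>1 / 4\<close>, the other rows obey the dyadic
  bound.\<close>

lemma exists_avoiding_subset:
  fixes v :: "'i \<Rightarrow> 'c \<Rightarrow> real" and \<mu> :: "'i \<Rightarrow> real"
  assumes fin: "finite I" "finite R" and pos: "\<tau> > 0" "\<theta> > 0"
    and rows: "\<And>i. i \<in> I \<Longrightarrow> spread \<tau> (v i) R \<or> L \<le> scales (v i) R"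
    and nonzero: "\<And>i. i \<in> I \<Longrightarrow> \<exists>c\<in>R. v i c \<noteq> 0"
    and degree: "\<And>c. c \<in> R \<Longrightarrow> real (card {i \<in> I. v i c \<noteq> 0}) \<le> D"
    and \<theta>D: "4 * \<theta> * D \<le> sqrt \<tau>"
    and p: "2 * exp (- 2 * \<theta>\<^sup>2) \<le> p" "(3 / 4) ^ L \<le> p" "real (card I) * p < 1"
  obtains A where "A \<subseteq> R" "\<And>i. i \<in> I \<Longrightarrow> sum (v i) A \<noteq> \<mu> i"
proof -
  define S where "S = {i \<in> I. spread \<tau> (v i) R}"
  define T where "T i = sqrt (\<Sum>c\<in>R. (v i c)\<^sup>2)" for i
  define w where "w i c = v i c / T i" for i c
  have finS: "finite S" using fin by (simp add: S_def)
  have Tpos: "T i > 0" if i: "i \<in> I" for i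
  proof -
    obtain c where "c \<in> R" "v i c \<noteq> 0" using nonzero[OF i] by blast
    then have "(\<Sum>c\<in>R. (v i c)\<^sup>2) > 0" using fin by (intro sum_pos2[of _ c]) auto
    then show ?thesis by (simp add: T_def)
  qed
  have T2: "(T i)\<^sup>2 = (\<Sum>c\<in>R. (v i c)\<^sup>2)" for i
    unfolding T_def by (intro real_sqrt_pow2 sum_nonneg) auto
  have norm: "(\<Sum>c\<in>R. (w i c)\<^sup>2) = 1" if "i \<in> I" for i
    using Tpos[OF that] unfolding w_def power_divide sum_divide_distrib[symmetric] T2[symmetric] by simp
  have w_le: "\<bar>w i c\<bar> \<le> 1 / sqrt \<tau>" if "i \<in> S" "c \<in> R" for i c
  proof -
    have i: "i \<in> I" using that by (simp add: S_def)
    have "\<tau> * (v i c)\<^sup>2 \<le> (T i)\<^sup>2" using that T2[of i] by (auto simp: S_def spread_def)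
    then have "(w i c)\<^sup>2 \<le> 1 / \<tau>"
      using Tpos[OF i] pos by (simp add: w_def power_divide field_simps)
    then have "sqrt ((w i c)\<^sup>2) \<le> sqrt (1 / \<tau>)" by (rule real_sqrt_le_mono)
    then show ?thesis by (simp add: real_sqrt_divide)
  qed
  \<comment> \<open>The Gram matrix of the normalised rows, hence symmetric with unit diagonal on
    \<open>S\<close>.\<close>
  define M where "M i j = (\<Sum>c\<in>R. w i c * w j c)" for i j
  \<comment> \<open>The target measured from the centre of the cube, where every coordinate is
    \<open>1 / 2\<close>.\<close>
  define \<nu> where "\<nu> i = \<mu> i / T i - (\<Sum>c\<in>R. 1 / 2 * w i c)" for i
  obtain \<epsilon> :: "'i \<Rightarrow> real" where \<epsilon>: "\<And>i. i \<in> S \<Longrightarrow> \<bar>\<epsilon> i\<bar> = 1"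
    "\<And>i. i \<in> S \<Longrightarrow> \<theta> \<le> \<bar>(\<Sum>j\<in>S. M i j * (\<theta> * \<epsilon> j)) - \<nu> i\<bar>"
  proof (rule Bang_signs[OF finS pos(2), of M \<nu>])
    show "M i j = M j i" for i j by (simp add: M_def mult.commute)
    show "M i i = 1" if "i \<in> S" for i
      using norm[of i] that by (simp add: M_def S_def power2_eq_square)
  qed blast
  define u where "u c = (\<Sum>j\<in>S. \<theta> * \<epsilon> j * w j c)" for c
  define q where "q c = 1 / 2 + u c" for c
  \<comment> \<open>At most \<open>D\<close> rows are nonzero at \<open>c\<close>, and each spread
    one contributes at most \<open>\<theta> / sqrt \<tau>\<close>.\<close>
  have u: "\<bar>u c\<bar> \<le> 1 / 4" if c: "c \<in> R" for c
  proof -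
    have "\<bar>u c\<bar> \<le> (\<Sum>j\<in>S. \<bar>\<theta> * \<epsilon> j * w j c\<bar>)" unfolding u_def by (rule sum_abs)
    also have "\<dots> = (\<Sum>j\<in>S. \<theta> * \<bar>w j c\<bar>)"
      using \<epsilon>(1) pos by (intro sum.cong) (auto simp: abs_mult)
    also have "\<dots> \<le> (\<Sum>j\<in>S. if v j c \<noteq> 0 then \<theta> / sqrt \<tau> else 0)"
    proof (rule sum_mono)
      fix j assume "j \<in> S"
      then show "\<theta> * \<bar>w j c\<bar> \<le> (if v j c \<noteq> 0 then \<theta> / sqrt \<tau> else 0)"
        using mult_left_mono[OF w_le[OF _ c], of j \<theta>] pos by (auto simp: w_def)
    qed
    also have "\<dots> = real (card {j \<in> S. v j c \<noteq> 0}) * (\<theta> / sqrt \<tau>)"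
      using finS by (simp flip: sum.inter_filter)
    also have "\<dots> \<le> D * (\<theta> / sqrt \<tau>)"
    proof (rule mult_right_mono)
      have "card {j \<in> S. v j c \<noteq> 0} \<le> card {i \<in> I. v i c \<noteq> 0}"
        using fin by (intro card_mono) (auto simp: S_def)
      then show "real (card {j \<in> S. v j c \<noteq> 0}) \<le> D" using degree[OF c] by linarith
    qed (use pos in auto)
    also have "\<dots> \<le> 1 / 4" using \<theta>D pos by (simp add: field_simps)
    finally show ?thesis .
  qed
  have q4: "1 / 4 \<le> q c \<and> q c \<le> 3 / 4" if "c \<in> R" for c
    using u[OF that] by (auto simp: q_def)
  have q01: "0 \<le> q c \<and> q c \<le> 1" if "c \<in> R" for c
    using q4[OF that] by auto
  have prob: "subset_prob q R (\<lambda>A. sum (v i) A = \<mu> i) \<le> p" if i: "i \<in> I" for i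
  proof (cases "i \<in> S")
    case True
    \<comment> \<open>The bias moves the mean of row \<open>i\<close> by entry \<open>i\<close> of
      \<open>M\<close> applied to the scaled signs, the quantity that Bang's lemma controls.\<close>
    have "(\<Sum>c\<in>R. u c * w i c) = (\<Sum>c\<in>R. \<Sum>j\<in>S. w i c * w j c * (\<theta> * \<epsilon> j))"
      unfolding u_def sum_distrib_right by (intro sum.cong refl) (simp add: ac_simps)
    also have "\<dots> = (\<Sum>j\<in>S. M i j * (\<theta> * \<epsilon> j))"
      unfolding M_def sum_distrib_right by (rule sum.swap)
    finally have "(\<Sum>c\<in>R. q c * w i c) - \<mu> i / T i = (\<Sum>j\<in>S. M i j * (\<theta> * \<epsilon> j)) - \<nu> i"
      by (simp add: q_def \<nu>_def distrib_right sum.distrib)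
    then have far: "\<theta> \<le> \<bar>(\<Sum>c\<in>R. q c * w i c) - \<mu> i / T i\<bar>" using \<epsilon>(2)[OF True] by simp
    have "subset_prob q R (\<lambda>A. sum (v i) A = \<mu> i) = subset_prob q R (\<lambda>A. sum (w i) A = \<mu> i / T i)"
      using Tpos[OF i] by (intro subset_prob_cong) (simp add: w_def flip: sum_divide_distrib)
    also have "\<dots> \<le> 2 * exp (- 2 * \<theta>\<^sup>2)"
      using norm[OF i] by (intro subset_prob_sum_eq_le_Hoeffding fin q01 pos far) auto
    finally show ?thesis using p by simp
  next
    case False
    then have "L \<le> scales (v i) R" using rows[OF i] i by (auto simp: S_def)
    obtain Z where Z: "Z \<subseteq> R" "dyadic (v i) Z" "card Z = scales (v i) R"
      using scales_attained[OF fin(2)] .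
    have "subset_prob q R (\<lambda>A. sum (v i) A = \<mu> i) \<le> (3 / 4) ^ card Z"
      by (rule subset_prob_sum_eq_dyadic_le[OF fin(2) Z(1,2) q4])
    also have "\<dots> \<le> (3 / 4) ^ L"
      using \<open>L \<le> scales (v i) R\<close> Z(3) by (intro power_decreasing) auto
    finally show ?thesis using p by simp
  qed
  have "(\<Sum>i\<in>I. subset_prob q R (\<lambda>A. sum (v i) A = \<mu> i)) \<le> (\<Sum>i\<in>I. p)"
    by (intro sum_mono prob)
  also have "\<dots> < 1" using p by simp
  finally show thesis
    using exists_subset_avoiding[of R I q "\<lambda>i A. sum (v i) A = \<mu> i"] fin q01 that by blast
qed

section \<open>The lower bound\<close>

text \<open>The negated bound lets all the parameters below coexist: few columns are lost, the
  remaining degrees are at most \<open>D\<close>, and \<open>\<tau>\<close> is still large enough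
  for \<open>exists_avoiding_subset\<close>.\<close>

lemma card_rows_lower_bound:
  fixes v :: "'i \<Rightarrow> 'c \<Rightarrow> real" and \<mu> :: "'i \<Rightarrow> real"
  assumes fin: "finite I" "finite N" and n2: "card N \<ge> 2"
    and cover: "\<And>A. A \<subseteq> N \<Longrightarrow> \<exists>i\<in>I. sum (v i) A = \<mu> i"
    and touch: "\<And>c. c \<in> N \<Longrightarrow> \<exists>i\<in>I. v i c \<noteq> 0"
    and minimal: "\<And>i. i \<in> I \<Longrightarrow> \<exists>A\<subseteq>N. sum (v i) A = \<mu> i \<and> (\<forall>j\<in>I - {i}. sum (v j) A \<noteq> \<mu> j)"
  shows "real (card N) ^ 3 \<le> 368640 * real (card I) ^ 5 * (ln (real (card N)))\<^sup>2"
proof (rule ccontr)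
  define k where "k = real (card I)"
  define n where "n = real (card N)"
  assume "\<not> ?thesis"
  then have few: "368640 * k ^ 5 * (ln n)\<^sup>2 < n ^ 3" by (simp add: k_def n_def)
  have n: "n \<ge> 2" using n2 by (simp add: n_def)
  have "N \<noteq> {}" using n2 by auto
  then have "I \<noteq> {}" using touch by blast
  then have k: "k \<ge> 1" using fin by (simp add: k_def Suc_le_eq card_gt_0_iff)
  have "ln n \<ge> ln 2" using n by simp
  then have ln: "ln n \<ge> 2 / 3" using ln2_ge_two_thirds by linarith
  have "(2 / 3)\<^sup>2 \<le> (ln n)\<^sup>2" using ln by (intro power_mono) auto
  then have "1 \<le> 368640 * (ln n)\<^sup>2" by (simp add: power2_eq_square)
  then have "k ^ 5 * 1 \<le> k ^ 5 * (368640 * (ln n)\<^sup>2)" using k by (intro mult_left_mono) auto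
  then have k5: "k ^ 5 < n ^ 3" using few by (simp add: ac_simps)
  have kn: "k \<le> n"
  proof (rule ccontr)
    assume "\<not> k \<le> n"
    then have "n ^ 3 \<le> k ^ 3" using n by (intro power_mono) auto
    also have "\<dots> \<le> k ^ 5" using k by (intro power_increasing) auto
    finally show False using k5 by simp
  qed
  \<comment> \<open>Chosen so that \<open>exp (- \<kappa>)\<close> is \<open>1 / n^3\<close>, hence
    at most \<open>1 / (4 * k)\<close>, which suits a union bound over \<open>k\<close>
    rows.\<close>
  define \<kappa> where "\<kappa> = 3 * ln n"
  have \<kappa>: "\<kappa> \<ge> 2" using ln by (simp add: \<kappa>_def)
  have "4 * k \<le> n ^ 3"
  proof -
    have "2 * 2 * n \<le> n * n * n" using n by (intro mult_mono) auto
    then show ?thesis using kn by (simp add: power3_eq_cube)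
  qed
  moreover have "exp \<kappa> = n ^ 3"
    using n unfolding \<kappa>_def by (metis exp_ln exp_of_nat_mult of_nat_numeral order_less_le_trans zero_less_numeral)
  ultimately have exp_le: "exp (- \<kappa>) \<le> 1 / (4 * k)"
    using k by (simp add: exp_minus inverse_eq_divide frac_le)
  \<comment> \<open>Then Hoeffding's bound becomes \<open>2 * exp (- \<kappa>)\<close>.\<close>
  define \<theta> where "\<theta> = sqrt (\<kappa> / 2)"
  \<comment> \<open>Enough scales for
    \<open>(3 / 4) ^ L \<le> exp (- L / 4) \<le> exp (- \<kappa>)\<close>.\<close>
  define L where "L = nat \<lceil>4 * \<kappa>\<rceil>"
  have L: "4 * \<kappa> \<le> real L" "real L \<le> 5 * \<kappa>" "real L > 0"
    using \<kappa> by (auto simp: L_def) linarith+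
  \<comment> \<open>Makes the loss \<open>4 * \<tau> * k * L\<close> in \<open>thinning\<close>
    equal to \<open>n / 4\<close>.\<close>
  define \<tau> where "\<tau> = n / (16 * k * real L)"
  \<comment> \<open>Four times the bound \<open>2 * k^2 / n\<close> on the average column degree, so
    that at most a quarter of the columns exceed it.\<close>
  define D where "D = 8 * k\<^sup>2 / n"
  have \<tau>: "\<tau> > 0" using n k L by (simp add: \<tau>_def)
  have \<theta>: "\<theta> > 0" "\<theta>\<^sup>2 = \<kappa> / 2" using \<kappa> by (auto simp: \<theta>_def)
  \<comment> \<open>The main use of the negated bound. With \<open>L \<le> 5 * \<kappa>\<close> and
    \<open>\<kappa> = 3 * ln n\<close>, the constant arises as
    \<open>8192 * 5 * 9 = 368640\<close>.\<close>
  have "(4 * \<theta> * D)\<^sup>2 \<le> \<tau>"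
  proof -
    have "8192 * k ^ 5 * (real L * \<kappa>) \<le> 8192 * k ^ 5 * (5 * \<kappa> * \<kappa>)"
      using k L \<kappa> by (intro mult_left_mono mult_right_mono) auto
    also have "\<dots> = 368640 * k ^ 5 * (ln n)\<^sup>2" by (simp add: \<kappa>_def power2_eq_square)
    finally have le: "8192 * k ^ 5 * (real L * \<kappa>) \<le> n ^ 3" using few by linarith
    have "(4 * \<theta> * D)\<^sup>2 = 16 * \<theta>\<^sup>2 * D\<^sup>2" by (simp add: power_mult_distrib)
    also have "\<dots> = 512 * \<kappa> * k ^ 4 / n\<^sup>2"
      unfolding \<theta> D_def by (simp add: power_divide power_mult_distrib flip: power_mult)
    also have "\<dots> \<le> \<tau>"
      using le n k L unfolding \<tau>_def by (simp add: field_simps power2_eq_square power3_eq_cube eval_nat_numeral)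
    finally show ?thesis .
  qed
  then have \<theta>D: "4 * \<theta> * D \<le> sqrt \<tau>" by (rule real_le_rsqrt)
  define deg where "deg c = card {i \<in> I. v i c \<noteq> 0}" for c
  define B where "B = {c \<in> N. D < real (deg c)}"
  have Dpos: "D > 0" using k n by (simp add: D_def)
  \<comment> \<open>Double counting of the nonzero entries, by columns and then by rows.\<close>
  have "D * real (card B) = (\<Sum>c\<in>B. D)" by simp
  also have "\<dots> \<le> (\<Sum>c\<in>B. real (deg c))" by (intro sum_mono) (auto simp: B_def)
  also have "\<dots> \<le> (\<Sum>c\<in>N. real (deg c))" using fin by (intro sum_mono2) (auto simp: B_def)
  also have "\<dots> = (\<Sum>c\<in>N. \<Sum>i\<in>I. if v i c \<noteq> 0 then 1 else 0)"
    using fin by (simp add: deg_def flip: sum.inter_filter)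
  also have "\<dots> = (\<Sum>i\<in>I. \<Sum>c\<in>N. if v i c \<noteq> 0 then 1 else 0)" by (rule sum.swap)
  also have "\<dots> = (\<Sum>i\<in>I. real (card {c \<in> N. v i c \<noteq> 0}))"
    using fin by (simp flip: sum.inter_filter)
  also have "\<dots> \<le> (\<Sum>i\<in>I. 2 * k)"
  proof (rule sum_mono)
    fix i assume i: "i \<in> I"
    obtain A where A: "A \<subseteq> N" "sum (v i) A = \<mu> i" "\<forall>j\<in>I - {i}. sum (v j) A \<noteq> \<mu> j"
      using minimal[OF i] by blast
    have "card {c \<in> N. v i c \<noteq> 0} \<le> 2 * card I"
      using card_support_le[OF fin i A(1) cover A(2)] A(3) by blast
    then show "real (card {c \<in> N. v i c \<noteq> 0}) \<le> 2 * k" by (simp add: k_def)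
  qed
  also have "\<dots> = D * (n / 4)" using n by (simp add: D_def k_def power2_eq_square)
  finally have B: "real (card B) \<le> n / 4" using Dpos by simp
  obtain R where R: "R \<subseteq> N - B" "real (card (N - B - R)) \<le> 4 * \<tau> * real (card I * L)"
    "\<And>i. i \<in> I \<Longrightarrow> spread \<tau> (v i) R \<or> L \<le> scales (v i) R"
    using thinning[of I "N - B" \<tau> L v] fin \<tau> by auto
  have "4 * \<tau> * real (card I * L) = n / 4"
    using k L by (simp add: \<tau>_def k_def[symmetric])
  then have "real (card (N - B - R)) \<le> n / 4" using R by simp
  moreover have "n \<le> real (card B + card (N - B - R) + card R)"
  proof -
    have "N = B \<union> (N - B - R) \<union> R" using R by (auto simp: B_def)
    then have "card N \<le> card (B \<union> (N - B - R)) + card R" by (metis card_Un_le)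
    moreover have "card (B \<union> (N - B - R)) \<le> card B + card (N - B - R)" by (rule card_Un_le)
    ultimately show ?thesis unfolding n_def by linarith
  qed
  \<comment> \<open>At least half of the columns remain.\<close>
  ultimately have "card R \<noteq> 0" using B n by auto
  then obtain c0 where c0: "c0 \<in> R" by (auto simp: card_eq_0_iff)
  have RN: "R \<subseteq> N" "finite R" using R fin by (auto intro: finite_subset)
  \<comment> \<open>Any row that does not vanish on \<open>R\<close> serves here: its witness
    \<open>A0\<close> avoids all other rows, in particular those vanishing on
    \<open>R\<close>.\<close>
  obtain i0 where i0: "i0 \<in> I" "v i0 c0 \<noteq> 0" using touch c0 RN by blast
  obtain A0 where A0: "A0 \<subseteq> N" "\<forall>j\<in>I - {i0}. sum (v j) A0 \<noteq> \<mu> j"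
    using minimal[OF i0(1)] by blast
  have finA0: "finite A0" using A0 fin finite_subset by blast
  define J where "J = {i \<in> I. \<exists>c\<in>R. v i c \<noteq> 0}"
  obtain A where A: "A \<subseteq> R" "\<And>i. i \<in> J \<Longrightarrow> sum (v i) A \<noteq> \<mu> i - sum (v i) (A0 - R)"
  proof (rule exists_avoiding_subset[of J R \<tau> \<theta> v L D "1 / (2 * k)" "\<lambda>i. \<mu> i - sum (v i) (A0 - R)"])
    show "finite J" "finite R" using fin RN by (auto simp: J_def)
    show "spread \<tau> (v i) R \<or> L \<le> scales (v i) R" if "i \<in> J" for i
      using R that by (auto simp: J_def)
    show "real (card {i \<in> J. v i c \<noteq> 0}) \<le> D" if c: "c \<in> R" for c
    proof -
      have "card {i \<in> J. v i c \<noteq> 0} \<le> deg c"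
        unfolding deg_def using fin by (intro card_mono) (auto simp: J_def)
      moreover have "real (deg c) \<le> D" using c R by (auto simp: B_def)
      ultimately show ?thesis by linarith
    qed
    show "2 * exp (- 2 * \<theta>\<^sup>2) \<le> 1 / (2 * k)"
      using exp_le k unfolding \<theta> by (simp add: field_simps)
    have "(3 / 4 :: real) ^ L \<le> exp (- 1 / 4) ^ L"
      using exp_ge_add_one_self[of "- 1 / 4"] by (intro power_mono) auto
    also have "\<dots> = exp (- (real L / 4))" by (simp flip: exp_of_nat_mult)
    also have "\<dots> \<le> exp (- \<kappa>)" using L by simp
    also have "\<dots> \<le> 1 / (4 * k)" by (rule exp_le)
    also have "\<dots> \<le> 1 / (2 * k)" using k by (simp add: field_simps)
    finally show "(3 / 4 :: real) ^ L \<le> 1 / (2 * k)" .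
    have "card J \<le> card I" using fin by (intro card_mono) (auto simp: J_def)
    then show "real (card J) * (1 / (2 * k)) < 1" using k by (simp add: k_def field_simps)
  qed (use \<tau> \<theta> \<theta>D in \<open>auto simp: J_def\<close>)
  have split: "sum (v i) ((A0 - R) \<union> A) = sum (v i) (A0 - R) + sum (v i) A" for i
    using finA0 RN A(1) by (intro sum.union_disjoint) (auto intro: finite_subset)
  obtain i where i: "i \<in> I" "sum (v i) ((A0 - R) \<union> A) = \<mu> i"
    using cover[of "(A0 - R) \<union> A"] A0 A RN by blast
  \<comment> \<open>The covering row vanishes on \<open>R\<close>, so it takes the same value at
    \<open>A0\<close>; being different from \<open>i0\<close>, it contradicts the choice of
    \<open>A0\<close>.\<close>
  then have "i \<notin> J" using A(2)[of i] split[of i] by auto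
  then have z: "v i c = 0" if "c \<in> R" for c using that i by (auto simp: J_def)
  have "i \<noteq> i0" using \<open>i \<notin> J\<close> i0 c0 by (auto simp: J_def)
  moreover have "sum (v i) A = 0" using z A by (intro sum.neutral) auto
  moreover have "sum (v i) (A0 - R) = sum (v i) A0"
    using finA0 z by (intro sum.mono_neutral_left) auto
  ultimately show False using A0(2) i split[of i] by auto
qed

section \<open>Points of the cube as sets of coordinates, and the final bound\<close>

lemma scalar_product_indicator:
  assumes "A \<subseteq> {1..n}"
  shows "Defs.scalar_product n v (\<lambda>j\<in>{1..n}. if j \<in> A then 1 else 0) = sum v A"
proof -
  have "Defs.scalar_product n v (\<lambda>j\<in>{1..n}. if j \<in> A then 1 else 0) = (\<Sum>j\<in>{1..n}. if j \<in> A then v j else 0)"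
    unfolding Defs.scalar_product_def by (intro sum.cong) auto
  also have "\<dots> = sum v A"
    using assms by (simp add: sum.inter_restrict[symmetric] Int_absorb1)
  finally show ?thesis .
qed

lemma indicator_in_cube: "(\<lambda>j\<in>{1..n}. if j \<in> A then 1 else 0) \<in> cube n"
  by (auto simp: cube_def)

lemma cube_point_eq_indicator:
  assumes "x \<in> cube n"
  obtains A where "A \<subseteq> {1..n}" "x = (\<lambda>j\<in>{1..n}. if j \<in> A then 1 else 0)"
proof (rule that[of "{j \<in> {1..n}. x j = 1}"])
  show "x = (\<lambda>j\<in>{1..n}. if j \<in> {j \<in> {1..n}. x j = 1} then 1 else 0)"
  proof
    fix j
    show "x j = (\<lambda>j\<in>{1..n}. if j \<in> {j \<in> {1..n}. x j = 1} then 1 else 0) j"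
      using assms by (auto simp: cube_def PiE_iff extensional_def restrict_def)
  qed
qed auto

lemma essential_cover_lower_bound:
  assumes n: "n \<ge> 2" and ec: "essential_cover n k v \<mu>"
  shows "real n ^ 3 \<le> 368640 * real k ^ 5 * (ln (real n))\<^sup>2"
proof -
  have "real (card {1..n}) ^ 3 \<le> 368640 * real (card {1..k}) ^ 5 * (ln (real (card {1..n})))\<^sup>2"
  proof (rule card_rows_lower_bound[of _ _ v \<mu>])
    fix A :: "nat set" assume A: "A \<subseteq> {1..n}"
    show "\<exists>i\<in>{1..k}. sum (v i) A = \<mu> i"
      using ec indicator_in_cube[of A n] scalar_product_indicator[OF A]
      unfolding essential_cover_def by metis
  next
    fix i assume i: "i \<in> {1..k}"
    obtain x where x: "x \<in> cube n" "Defs.scalar_product n (v i) x = \<mu> i"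
      "\<forall>j\<in>{1..k} - {i}. Defs.scalar_product n (v j) x \<noteq> \<mu> j"
      using ec i unfolding essential_cover_def by blast
    obtain A where A: "A \<subseteq> {1..n}" "x = (\<lambda>j\<in>{1..n}. if j \<in> A then 1 else 0)"
      using cube_point_eq_indicator[OF x(1)] .
    show "\<exists>A\<subseteq>{1..n}. sum (v i) A = \<mu> i \<and> (\<forall>j\<in>{1..k} - {i}. sum (v j) A \<noteq> \<mu> j)"
      using x(2,3) A(1) unfolding A(2) scalar_product_indicator[OF A(1)] by blast
  next
    fix c assume "c \<in> {1..n}"
    then show "\<exists>i\<in>{1..k}. v i c \<noteq> 0" using ec unfolding essential_cover_def by blast
  qed (use n in auto)
  then show ?thesis by simp
qed

text \<open>Fifth roots in \<open>essential_cover_lower_bound\<close> give exponents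
  \<open>3/5\<close> for \<open>n\<close> and \<open>2/5\<close> for the logarithm; this dominates
  the stated bound.\<close>

theorem theorem1p2:
  shows "\<exists>c::real. c > 0 \<and>
    (\<forall>(n::nat) (k::nat) (v::nat \<Rightarrow> nat \<Rightarrow> real) (\<mu>::nat \<Rightarrow> real).
       n \<ge> 2 \<longrightarrow> essential_cover n k v \<mu> \<longrightarrow>
       real k \<ge> c * (real n powr (5/9) / (ln (real n)) powr (4/9)))"
proof -
  define K :: real where "K = 368640"
  have "K powr (- 1 / 5) * (real n powr (5/9) / (ln (real n)) powr (4/9)) \<le> real k"
    if n: "n \<ge> 2" and ec: "essential_cover n k v \<mu>" for n k v \<mu>
  proof -
    have ln: "ln (real n) \<ge> 2 / 3"
    proof -
      have "ln 2 \<le> ln (real n)" using n by simp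
      then show ?thesis using ln2_ge_two_thirds by linarith
    qed
    have "1 \<le> 2 * (2 / 3 :: real)" by simp
    also have "\<dots> \<le> real n * ln (real n)" using n ln by (intro mult_mono) auto
    \<comment> \<open>The gaps \<open>3/5 - 5/9\<close> and \<open>4/9 - 2/5\<close> both equal
      \<open>2/45\<close>, so the ratio of the two bounds is a power of
      \<open>n * ln n\<close>.\<close>
    finally have "1 \<le> (real n * ln (real n)) powr (2/45)" by (intro ge_one_powr_ge_zero) auto
    also have "\<dots> = real n powr (3/5 - 5/9) * ln (real n) powr (4/9 - 2/5)"
      using n ln by (simp add: powr_mult)
    also have "\<dots> = (real n powr (3/5) / ln (real n) powr (2/5)) / (real n powr (5/9) / (ln (real n)) powr (4/9))"
      using n ln by (simp only: powr_diff) simp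
    finally have ratio: "real n powr (5/9) / (ln (real n)) powr (4/9) \<le> real n powr (3/5) / ln (real n) powr (2/5)"
      using n ln by (subst (asm) le_divide_eq_1_pos) auto
    have "real n powr (3/5) = (real n ^ 3) powr (1/5)"
      using n powr_powr[of "real n" 3 "1/5"] by simp
    also have "\<dots> \<le> (K * real k ^ 5 * (ln (real n))\<^sup>2) powr (1/5)"
      using essential_cover_lower_bound[OF n ec] by (intro powr_mono2) (auto simp: K_def)
    also have "\<dots> = K powr (1/5) * (real k ^ 5) powr (1/5) * ((ln (real n))\<^sup>2) powr (1/5)"
      by (simp add: powr_mult K_def)
    also have "(real k ^ 5) powr (1/5) = real k"
      using powr_powr[of "real k" 5 "1/5"] by (cases "k = 0") simp_all
    also have "((ln (real n))\<^sup>2) powr (1/5) = ln (real n) powr (2/5)"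
      using ln powr_powr[of "ln (real n)" 2 "1/5"] by simp
    finally have "real n powr (3/5) / ln (real n) powr (2/5) \<le> K powr (1/5) * real k"
      using ln by (simp add: divide_le_eq)
    then have "K powr (- 1 / 5) * (real n powr (5/9) / (ln (real n)) powr (4/9)) \<le> K powr (- 1 / 5) * (K powr (1/5) * real k)"
      using ratio by (intro mult_left_mono) auto
    also have "\<dots> = real k"
      by (simp add: K_def mult.assoc[symmetric] flip: powr_add)
    finally show ?thesis .
  qed
  moreover have "K powr (- 1 / 5) > 0" by (simp add: K_def)
  ultimately show ?thesis by blast
qed

end
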